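(* Let $n\ge 2$, let $S$ be a semitransitive subsemigroup of $\mathcal{I}_n\setminus\mathcal{S}_n$, and let $p$ be the greatest proper divisor of $n$ (so $p=1$ if $n$ is prime). Then $|S|\ge 2n-p+1$.
   Context: $\mathcal{I}_n$ denotes the symmetric inverse semigroup of all partial injective maps of $X=\{1,\dots,n\}$ to itself (including the empty map). $\mathcal{S}_n$ is the symmetric group on $X$, so $\mathcal{I}_n\setminus\mathcal{S}_n$ consists of the non-invertible partial injections. A semigroup $S$ of partial transformations of $X$ is semitransitive if for all $x,y\in X$ there is $\varphi\in S$ with $x\varphi=y$ or $y\varphi=x$. A proper divisor of $n$ is a positive divisor different from $n$. *)

theory Defs
  imports Main
begin

definition partial_inj :: "nat \<Rightarrow> (nat \<rightharpoonup> nat) \<Rightarrow> bool" where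
  "partial_inj n f \<longleftrightarrow> dom f \<subseteq> {1..n} \<and> ran f \<subseteq> {1..n} \<and> inj_on f (dom f)"

definition is_perm :: "nat \<Rightarrow> (nat \<rightharpoonup> nat) \<Rightarrow> bool" where
  "is_perm n f \<longleftrightarrow> partial_inj n f \<and> dom f = {1..n} \<and> ran f = {1..n}"

definition nonperm_pinj :: "nat \<Rightarrow> (nat \<rightharpoonup> nat) set" where
  "nonperm_pinj n = {f. partial_inj n f \<and> \<not> is_perm n f}"

text \<open>Closure under composition (x(\<phi>\<psi>) = (x\<phi>)\<psi>, i.e. map composition psi after phi).\<close>
definition comp_closed :: "(nat \<rightharpoonup> nat) set \<Rightarrow> bool" where
  "comp_closed S \<longleftrightarrow> (\<forall>\<phi>\<in>S. \<forall>\<psi>\<in>S. \<psi> \<circ>\<^sub>m \<phi> \<in> S)"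

definition semitransitive :: "nat \<Rightarrow> (nat \<rightharpoonup> nat) set \<Rightarrow> bool" where
  "semitransitive n S \<longleftrightarrow>
     (\<forall>x\<in>{1..n}. \<forall>y\<in>{1..n}. \<exists>\<phi>\<in>S. \<phi> x = Some y \<or> \<phi> y = Some x)"

definition greatest_proper_divisor :: "nat \<Rightarrow> nat" where
  "greatest_proper_divisor n = Max {d. d dvd n \<and> d \<noteq> n}"

end

theory Submission
  imports Defs
begin

text \<open>
  Write \<open>w \<ge> v\<close> if some element of \<open>S\<close> maps \<open>w\<close> to \<open>v\<close>; this is a total preorder on \<open>X\<close>, and \<open>S\<close>
  contains the empty map. Let \<open>D w\<close> be the domain of the least idempotent fixing \<open>w\<close>, and call the
  fibres of \<open>D\<close> classes. Multiplying by idempotents, every related pair \<open>w \<ge> v\<close> is realised by a map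
  from \<open>D w\<close> to \<open>D v\<close>, and such maps determine the pair \<open>(D w, D v)\<close>. Counting the maps from the top
  of each class into that class, and the maps linking a point of a smallest class to all other
  classes, settles the case of at least three classes (one more pair of classes gives the surplus)
  and that of two classes of equal size. One class is impossible, as \<open>S\<close> contains no permutation.

  With two classes of different sizes the classes are the sets \<open>D w\<close>. The cells, i.e. the classes of
  the equivalence \<open>w \<ge> v \<ge> w\<close>, are then the orbits of the groups of units of \<open>e S e\<close>, for \<open>e\<close> the identity on
  a class, and all other elements of \<open>e S e'\<close> strictly decrease. The strictly decreasing
  elements form an ideal. For cells \<open>K \<ge> L\<close> consider the maps from \<open>K\<close> to \<open>L\<close> lying in the highest possible power
  of this ideal: the groups act on them, so their number is divisible by \<open>|K|\<close> and \<open>|L|\<close>, and maximality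
  keeps these sets disjoint for the pairs of cells that involve the top cell of \<open>X\<close> or the top cell of the
  other class. With \<open>a\<close>, \<open>b\<close> the sizes of these two cells, summing
  \<open>lcm a |K| + lcm b |K|\<close> over all cells gives at least \<open>2n - g\<close> nonempty maps, where
  \<open>g = gcd a b\<close> if \<open>gcd a b\<close> divides all cell sizes, and \<open>g = 1\<close> otherwise.
\<close>

section \<open>Arithmetic of least common multiples and transitive actions\<close>

lemma restrict_Some_comp: "(Some |` A) \<circ>\<^sub>m (Some |` B) = Some |` (A \<inter> B)"
  by (rule ext) (auto simp: map_comp_def restrict_map_def)

lemma restrict_Some_iff: "(Some |` A) x = Some y \<longleftrightarrow> x \<in> A \<and> y = x"
  by (auto simp: restrict_map_def)

lemma map_comp_assoc: "h \<circ>\<^sub>m (g \<circ>\<^sub>m f) = (h \<circ>\<^sub>m g) \<circ>\<^sub>m f"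
  by (rule ext) (auto simp: map_comp_def split: option.splits)

lemma dom_map_comp_subset: "dom (g \<circ>\<^sub>m f) \<subseteq> dom f"
  by (auto simp: map_comp_def split: option.splits)

lemma ran_map_comp_subset: "ran (g \<circ>\<^sub>m f) \<subseteq> ran g"
  by (auto simp: map_comp_def ran_def split: option.splits)

text \<open>Each \<open>t\<close> injects the fibre of \<open>pos\<close> over \<open>u\<close> into
  the fibre over \<open>v\<close>; by symmetry all fibres over \<open>K\<close> have the same
  size.\<close>

lemma card_dvd_card_if_transitive:
  assumes "finite M" "finite K" and pos: "\<And>f. f \<in> M \<Longrightarrow> pos f \<in> K"
    and trans: "\<And>u v. u \<in> K \<Longrightarrow> v \<in> K \<Longrightarrow>
      \<exists>t. inj_on t M \<and> t ` M \<subseteq> M \<and> (\<forall>f\<in>M. pos f = u \<longrightarrow> pos (t f) = v)"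
  shows "card K dvd card M"
proof (cases "finite K \<and> K \<noteq> {}")
  case True
  then obtain k where k: "k \<in> K" by auto
  define F where "F u = {f \<in> M. pos f = u}" for u
  have finF: "finite (F u)" for u using \<open>finite M\<close> by (auto simp: F_def)
  have le: "card (F u) \<le> card (F v)" if uv: "u \<in> K" "v \<in> K" for u v
  proof -
    obtain t where t: "inj_on t M" "t ` M \<subseteq> M" "\<forall>f\<in>M. pos f = u \<longrightarrow> pos (t f) = v"
      using trans[OF uv] by blast
    show ?thesis
    proof (rule card_inj_on_le[of t])
      show "inj_on t (F u)" using t(1) by (auto simp: F_def inj_on_def)
      show "t ` F u \<subseteq> F v" using t by (auto simp: F_def)
    qed (rule finF)
  qed
  have eq: "card (F u) = card (F k)" if "u \<in> K" for u
    using le[OF that k] le[OF k that] by simp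
  have "M = (\<Union>u\<in>K. F u)" using pos by (auto simp: F_def)
  then have "card M = card (\<Union>u\<in>K. F u)" by simp
  also have "\<dots> = (\<Sum>u\<in>K. card (F u))"
    using True finF by (intro card_UN_disjoint) (auto simp: F_def)
  also have "\<dots> = (\<Sum>u\<in>K. card (F k))" by (rule sum.cong) (auto simp: eq)
  also have "\<dots> = card K * card (F k)" by simp
  finally show ?thesis by simp
next
  case False
  then have "M = {}" using assms(2) pos by auto
  then show ?thesis by simp
qed

text \<open>\<open>lcm a m\<close> is a multiple of \<open>m\<close> other than \<open>m\<close>
  itself, hence at least \<open>2 * m\<close>, and it is also at least \<open>a\<close>; the bound
  adds the two.\<close>

lemma lcm_excess:
  fixes a m :: nat
  assumes "m > 0" "a > 0" "\<not> a dvd m"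
  shows "2 * lcm a m \<ge> 2 * m + a"
proof -
  obtain c where c: "lcm a m = m * c" by (metis dvd_def dvd_lcm2)
  have "c \<noteq> 0" using c assms by (metis gr0I lcm_pos_nat mult_0_right neq0_conv)
  moreover have "c \<noteq> 1" using c assms(3) by (metis dvd_lcm1 mult.right_neutral)
  ultimately have "2 \<le> c" by simp
  then have "2 * m \<le> lcm a m" using c by simp
  moreover have "a \<le> lcm a m" using assms by (simp add: dvd_imp_le lcm_pos_nat)
  ultimately show ?thesis by linarith
qed

text \<open>After division by the gcd this is \<open>(c - 1) * (d - 1) \<ge> 0\<close> for the
  cofactors \<open>c\<close> and \<open>d\<close>.\<close>

lemma lcm_add_gcd_ge:
  fixes a b :: nat
  assumes "a > 0" "b > 0"
  shows "lcm a b + gcd a b \<ge> a + b"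
proof -
  define g where "g = gcd a b"
  have g: "g > 0" using assms by (simp add: g_def)
  obtain c d where cd: "a = g * c" "b = g * d" by (metis dvdE gcd_dvd1 gcd_dvd2 g_def)
  have pos: "c > 0" "d > 0" using cd assms by auto
  have "g * lcm a b = a * b" unfolding g_def by (rule prod_gcd_lcm_nat[symmetric])
  then have "lcm a b = g * (c * d)" using cd g by auto
  moreover have "c * d + 1 \<ge> c + d"
  proof -
    obtain c' d' where "c = Suc c'" "d = Suc d'" using pos by (metis gr0_implies_Suc)
    then show ?thesis by simp
  qed
  then have "g * (c * d + 1) \<ge> g * (c + d)" by (rule mult_le_mono2)
  then have "a + b \<le> g * (c * d) + g" using cd by (simp add: algebra_simps)
  ultimately show ?thesis by (simp add: g_def)
qed

text \<open>Each lcm is at least \<open>m w\<close>, and the single mixed lcm of the pair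
  \<open>x\<close>, \<open>y\<close> falls short by at most \<open>gcd (m x) (m y)\<close>. If this
  gcd divides all \<open>m w\<close>, it serves as \<open>g\<close>; otherwise an index violating
  this makes up for the loss and \<open>g = 1\<close> works.\<close>

lemma sum_lcm_lower_bound:
  fixes m :: "'a \<Rightarrow> nat"
  assumes "finite C" and xy: "x \<in> C" "y \<in> C" "x \<noteq> y" and pos: "\<And>w. w \<in> C \<Longrightarrow> m w > 0"
  obtains g where "g dvd (\<Sum>w\<in>C. m w)" "g < (\<Sum>w\<in>C. m w)"
    "2 * (\<Sum>w\<in>C. m w) \<le> (\<Sum>w\<in>C. lcm (m x) (m w)) + (\<Sum>w\<in>C-{x}. lcm (m y) (m w)) + g"
proof -
  let ?a = "m x" and ?b = "m y"
  let ?R = "C - {x} - {y}"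
  define g where "g = gcd ?a ?b"
  have ab: "?a > 0" "?b > 0" using pos xy by auto
  have sm: "(\<Sum>w\<in>C. m w) = ?a + (?b + (\<Sum>w\<in>?R. m w))"
    using assms by (simp add: sum.remove[of C x] sum.remove[of "C - {x}" y])
  have s1: "(\<Sum>w\<in>C. lcm ?a (m w)) = ?a + (lcm ?a ?b + (\<Sum>w\<in>?R. lcm ?a (m w)))"
    using assms by (simp add: sum.remove[of C x] sum.remove[of "C - {x}" y])
  have s2: "(\<Sum>w\<in>C-{x}. lcm ?b (m w)) = ?b + (\<Sum>w\<in>?R. lcm ?b (m w))"
    using assms by (simp add: sum.remove[of "C - {x}" y])
  have lg: "lcm ?a ?b + g \<ge> ?a + ?b" unfolding g_def by (rule lcm_add_gcd_ge[OF ab])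
  have le1: "m w \<le> lcm k (m w)" if "w \<in> C" "k > 0" for k w
    using pos[OF that(1)] that(2) by (simp add: dvd_imp_le lcm_pos_nat)
  have gle: "g \<le> ?a" "g \<le> ?b" using ab by (auto simp: g_def)
  show ?thesis
  proof (cases "\<forall>w\<in>?R. g dvd m w")
    case True
    have "g dvd (\<Sum>w\<in>C. m w)" unfolding sm using True by (auto simp: g_def intro!: dvd_add dvd_sum)
    moreover have "g < (\<Sum>w\<in>C. m w)" using sm gle ab by linarith
    moreover have "(\<Sum>w\<in>?R. m w) \<le> (\<Sum>w\<in>?R. lcm ?a (m w))"
      "(\<Sum>w\<in>?R. m w) \<le> (\<Sum>w\<in>?R. lcm ?b (m w))"
      using le1 ab by (auto intro!: sum_mono)
    then have "2 * (\<Sum>w\<in>C. m w) \<le> (\<Sum>w\<in>C. lcm ?a (m w)) + (\<Sum>w\<in>C-{x}. lcm ?b (m w)) + g"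
      using sm s1 s2 lg by linarith
    ultimately show ?thesis by (rule that)
  next
    case False
    then obtain v where v: "v \<in> ?R" "\<not> g dvd m v" by auto
    have nd: "\<not> ?a dvd m v" "\<not> ?b dvd m v"
      using v(2) unfolding g_def by (meson dvd_trans gcd_dvd1 gcd_dvd2)+
    have mv: "m v > 0" using v pos by auto
    \<comment> \<open>The two excess bounds add up to a doubled surplus of
      \<open>?a + ?b \<ge> 2 * g\<close>, hence a surplus of \<open>g\<close>, which absorbs the gcd
      loss.\<close>
    note ex = lcm_excess[OF mv ab(1) nd(1)] lcm_excess[OF mv ab(2) nd(2)]
    have "(\<Sum>w\<in>?R-{v}. m w) \<le> (\<Sum>w\<in>?R-{v}. lcm ?a (m w))"
      "(\<Sum>w\<in>?R-{v}. m w) \<le> (\<Sum>w\<in>?R-{v}. lcm ?b (m w))"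
      using le1 ab by (auto intro!: sum_mono)
    moreover have split: "(\<Sum>w\<in>?R. f w) = f v + (\<Sum>w\<in>?R-{v}. f w)" for f :: "'a \<Rightarrow> nat"
      using v(1) assms(1) by (simp add: sum.remove)
    ultimately have "2 * (\<Sum>w\<in>?R. m w) + g \<le> (\<Sum>w\<in>?R. lcm ?a (m w)) + (\<Sum>w\<in>?R. lcm ?b (m w))"
      using ex gle split[of m] split[of "\<lambda>w. lcm ?a (m w)"] split[of "\<lambda>w. lcm ?b (m w)"] by linarith
    then have "2 * (\<Sum>w\<in>C. m w) \<le> (\<Sum>w\<in>C. lcm ?a (m w)) + (\<Sum>w\<in>C-{x}. lcm ?b (m w)) + 1"
      using sm s1 s2 lg by linarith
    moreover have "1 < (\<Sum>w\<in>C. m w)" using sm ab by linarith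
    ultimately show ?thesis using that[of 1] by simp
  qed
qed

section \<open>Semitransitive semigroups of partial injections\<close>

text \<open>Only the identity is excluded explicitly: a permutation of \<open>X\<close> in
  \<open>S\<close> would have it as a power.\<close>

locale semitransitive_pinj =
  fixes X :: "'a set" and S :: "('a \<rightharpoonup> 'a) set"
  assumes finite_X: "finite X" and X_nonempty: "X \<noteq> {}"
    and dom_S: "f \<in> S \<Longrightarrow> dom f \<subseteq> X"
    and ran_S: "f \<in> S \<Longrightarrow> ran f \<subseteq> X"
    and inj_S: "f \<in> S \<Longrightarrow> f x = Some z \<Longrightarrow> f y = Some z \<Longrightarrow> x = y"
    and comp_S: "f \<in> S \<Longrightarrow> g \<in> S \<Longrightarrow> g \<circ>\<^sub>m f \<in> S"
    and semitrans: "x \<in> X \<Longrightarrow> y \<in> X \<Longrightarrow> \<exists>f\<in>S. f x = Some y \<or> f y = Some x"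
    and id_notin_S: "Some |` X \<notin> S"
begin

lemma finite_S: "finite S"
proof (rule finite_subset)
  show "S \<subseteq> (\<Union>A\<in>Pow X. {f. dom f = A \<and> ran f \<subseteq> X})"
    using dom_S ran_S by auto
  show "finite (\<Union>A\<in>Pow X. {f. dom f = A \<and> ran f \<subseteq> X})"
    using finite_X by (auto intro!: finite_set_of_finite_maps intro: finite_subset)
qed

lemma in_X: "f \<in> S \<Longrightarrow> f w = Some v \<Longrightarrow> w \<in> X \<and> v \<in> X"
  using dom_S ran_S by (meson domI ranI subsetD)

lemma card_ran: "f \<in> S \<Longrightarrow> card (ran f) = card (dom f)"
proof -
  assume f: "f \<in> S"
  have "ran f = (\<lambda>x. the (f x)) ` dom f" by (force simp: ran_def dom_def image_def)
  moreover have "inj_on (\<lambda>x. the (f x)) (dom f)"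
    using inj_S[OF f] by (force simp: inj_on_def dom_def)
  ultimately show ?thesis by (simp add: card_image)
qed

text \<open>By finiteness two powers of \<open>f\<close> coincide, so some power is idempotent, and
  an injective idempotent is a partial identity. Fixed points of \<open>f\<close> stay fixed under
  every power.\<close>

lemma idempotent_power:
  assumes f: "f \<in> S"
  obtains A where "Some |` A \<in> S" "A \<subseteq> dom f" "A \<subseteq> ran f" "\<And>w. f w = Some w \<Longrightarrow> w \<in> A"
proof -
  \<comment> \<open>\<open>p k\<close> is the power of \<open>f\<close> with exponent
    \<open>k + 1\<close>, whence the \<open>Suc\<close> in \<open>padd\<close>.\<close>
  define p where "p k = ((\<lambda>g. f \<circ>\<^sub>m g) ^^ k) f" for k
  have p0: "p 0 = f" and pS: "p (Suc k) = f \<circ>\<^sub>m p k" for k by (auto simp: p_def)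
  have pin: "p k \<in> S" for k by (induction k) (auto simp: p0 pS f comp_S)
  have padd: "p i \<circ>\<^sub>m p j = p (Suc (i + j))" for i j
    by (induction i) (auto simp: p0 pS map_comp_assoc[symmetric])
  have pfix: "p k w = Some w" if "f w = Some w" for k w
    by (induction k) (auto simp: p0 pS that)
  have pdom: "dom (p k) \<subseteq> dom f" for k
  proof (induction k)
    case (Suc k)
    then show ?case unfolding pS using dom_map_comp_subset by (rule subset_trans[rotated])
  qed (simp add: p0)
  have pran: "ran (p k) \<subseteq> ran f" for k
    by (cases k) (simp_all add: p0 pS ran_map_comp_subset)
  have "\<not> inj p"
    using finite_S pin by (metis finite_imageD finite_subset image_subsetI infinite_UNIV_nat)
  then obtain i j where "p i = p j" "i \<noteq> j" by (auto simp: inj_def)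
  then obtain i j where ij: "p i = p j" "i < j" by (metis linorder_neqE_nat)
  define per where "per = j - i"
  have per: "per > 0" "j = i + per" using ij by (auto simp: per_def)
  have step: "p (i + t + per) = p (i + t)" for t
  proof (induction t)
    case 0 then show ?case using ij per by simp
  next
    case (Suc t) then show ?case by (simp add: pS)
  qed
  have steps: "p (i + t + c * per) = p (i + t)" for t c
  proof (induction c)
    case (Suc c)
    then show ?case using step[of "t + c * per"] by (simp add: algebra_simps)
  qed simp
  \<comment> \<open>The exponent \<open>Suc T\<close> is a multiple of the period lying beyond the
    preperiod, so doubling it gives the same map.\<close>
  define T where "T = Suc i * per - 1"
  have T: "Suc T = Suc i * per" using per by (simp add: T_def)
  have "i \<le> T" using T per by (metis Suc_le_mono mult.right_neutral mult_le_mono2 Suc_leI One_nat_def)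
  then obtain t where t: "T = i + t" by (metis le_Suc_ex)
  have "p T \<circ>\<^sub>m p T = p (T + Suc T)" by (simp add: padd)
  also have "\<dots> = p T" using steps[of t "Suc i"] unfolding T unfolding t by simp
  finally have idem: "p T \<circ>\<^sub>m p T = p T" .
  have pT: "p T x = Some y \<Longrightarrow> y = x" for x y
  proof -
    assume xy: "p T x = Some y"
    then have "(p T \<circ>\<^sub>m p T) x = Some y" by (simp add: idem)
    then have "p T y = Some y" using xy by simp
    then show "y = x" using inj_S[OF pin xy] by simp
  qed
  have eq: "p T = Some |` dom (p T)"
    by (rule ext) (auto simp: restrict_map_def dom_def dest: pT)
  show ?thesis
  proof (rule that[of "dom (p T)"])
    show "Some |` dom (p T) \<in> S" using pin eq by metis
    show "dom (p T) \<subseteq> dom f" by (rule pdom)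
    show "dom (p T) \<subseteq> ran f" using pran[of T] pT by (auto simp: ran_def dom_def) blast
    show "w \<in> dom (p T)" if "f w = Some w" for w using pfix[OF that, of T] by auto
  qed
qed

section \<open>The reachability preorder\<close>

definition reach :: "'a \<Rightarrow> 'a \<Rightarrow> bool" where
  "reach w v \<longleftrightarrow> (\<exists>f\<in>S. f w = Some v)"

lemma reach_trans: "reach u v \<Longrightarrow> reach v w \<Longrightarrow> reach u w"
proof -
  assume "reach u v" "reach v w"
  then obtain f g where "f \<in> S" "g \<in> S" "f u = Some v" "g v = Some w" by (auto simp: reach_def)
  then have "g \<circ>\<^sub>m f \<in> S" "(g \<circ>\<^sub>m f) u = Some w" by (auto simp: comp_S)
  then show ?thesis unfolding reach_def by blast
qed

lemma reach_total: "w \<in> X \<Longrightarrow> v \<in> X \<Longrightarrow> reach w v \<or> reach v w"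
  using semitrans unfolding reach_def by blast

lemma reach_refl: "w \<in> X \<Longrightarrow> reach w w"
  using reach_total by blast

lemma reach_in_X: "reach w v \<Longrightarrow> w \<in> X \<and> v \<in> X"
  using in_X unfolding reach_def by blast

text \<open>A rank function for the preorder: it turns strict descent into a decrease of natural
  numbers.\<close>

definition reached :: "'a \<Rightarrow> nat" where
  "reached w = card {u. reach w u}"

lemma finite_reach: "finite {u. reach w u}"
  using reach_in_X by (intro finite_subset[OF _ finite_X]) auto

lemma reached_mono: "reach w v \<Longrightarrow> reached v \<le> reached w"
  unfolding reached_def using reach_trans by (intro card_mono finite_reach) blast

lemma reached_strict: "reach w v \<Longrightarrow> \<not> reach v w \<Longrightarrow> reached v < reached w"
  unfolding reached_def
proof (intro psubset_card_mono finite_reach psubsetI)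
  assume r: "reach w v" "\<not> reach v w"
  then show "{u. reach v u} \<subseteq> {u. reach w u}" using reach_trans by blast
  have "reach w w" using r reach_in_X reach_refl by blast
  then show "{u. reach v u} \<noteq> {u. reach w u}" using r by blast
qed

lemma top_exists:
  assumes "A \<subseteq> X" "A \<noteq> {}"
  obtains t where "t \<in> A" "\<And>v. v \<in> A \<Longrightarrow> reach t v"
proof -
  have "finite A" using assms finite_X finite_subset by blast
  then have "finite (reached ` A)" "reached ` A \<noteq> {}" using assms by auto
  then have "Max (reached ` A) \<in> reached ` A" by (rule Max_in)
  then obtain t where t: "t \<in> A" "reached t = Max (reached ` A)" by auto
  have "reach t v" if v: "v \<in> A" for v
  proof (rule ccontr)
    assume "\<not> reach t v"
    then have "reached t < reached v" using reach_total assms t v reached_strict by blast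
    moreover have "reached v \<le> reached t" using v t \<open>finite A\<close> by simp
    ultimately show False by simp
  qed
  then show ?thesis using that t by blast
qed

text \<open>If the smallest domain were nonempty, every map in \<open>S\<close> would permute the
  set \<open>A\<close> fixed by an idempotent of that size, and no point of \<open>A\<close> could
  be related to a point outside.\<close>

lemma empty_in_S: "Map.empty \<in> S"
proof -
  obtain x0 where "x0 \<in> X" using X_nonempty by auto
  then have "S \<noteq> {}" using semitrans by blast
  then obtain f where f: "f \<in> S" "\<And>g. g \<in> S \<Longrightarrow> card (dom f) \<le> card (dom g)"
    using ex_has_least_nat[of "\<lambda>f. f \<in> S" _ "\<lambda>f. card (dom f)"] by blast
  obtain A where A: "Some |` A \<in> S" "A \<subseteq> dom f"
    by (rule idempotent_power[OF f(1)]) (rule that)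
  have finA: "finite A" and AX: "A \<subseteq> X" using A(1) dom_S finite_X finite_subset by fastforce+
  show ?thesis
  proof (cases "A = {}")
    case True
    then have "Some |` A = Map.empty" by (auto simp: restrict_map_def)
    then show ?thesis using A(1) by simp
  next
    case False
    then obtain x where x: "x \<in> A" by auto
    obtain y where y: "y \<in> X" "y \<notin> A" using A(1) AX id_notin_S by (metis subsetI subset_antisym)
    \<comment> \<open>Sandwiching \<open>g\<close> between copies of the idempotent cannot shrink
      the domain below the minimal size, so \<open>g\<close> maps all of \<open>A\<close> into
      \<open>A\<close>.\<close>
    have total: "\<exists>b\<in>A. g a = Some b" if "g \<in> S" "a \<in> A" for g a
    proof -
      let ?h = "(Some |` A) \<circ>\<^sub>m (g \<circ>\<^sub>m (Some |` A))"
      have h: "?h \<in> S" using A(1) that by (simp add: comp_S)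
      have sub: "dom ?h \<subseteq> A" by (auto simp: map_comp_def restrict_map_def split: option.splits if_splits)
      have "card A \<le> card (dom f)"
        using A(2) f(1) dom_S finite_X by (meson card_mono finite_subset)
      then have "card A \<le> card (dom ?h)" using f(2)[OF h] by simp
      then have "dom ?h = A" using card_seteq[OF finA sub] by simp
      then have "a \<in> dom ?h" using that by simp
      then show ?thesis
        by (auto simp: map_comp_def restrict_map_def split: option.splits if_splits)
    qed
    obtain g where g: "g \<in> S" "g x = Some y \<or> g y = Some x" using semitrans x y AX by blast
    have "g x \<noteq> Some y" using total[OF g(1) x] y by auto
    then have gy: "g y = Some x" using g by simp
    \<comment> \<open>Since \<open>g\<close> permutes \<open>A\<close>, the point \<open>x\<close>
      already has a preimage in \<open>A\<close> and cannot have \<open>y\<close> as a second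
      one.\<close>
    have "(\<lambda>a. the (g a)) ` A = A"
    proof (rule endo_inj_surj[OF finA])
      show "(\<lambda>a. the (g a)) ` A \<subseteq> A" using total[OF g(1)] by fastforce
      show "inj_on (\<lambda>a. the (g a)) A"
      proof (rule inj_onI)
        fix a b assume ab: "a \<in> A" "b \<in> A" "the (g a) = the (g b)"
        then obtain c where "g a = Some c" "g b = Some c" using total[OF g(1)] by fastforce
        then show "a = b" by (rule inj_S[OF g(1)])
      qed
    qed
    then obtain a where "a \<in> A" "the (g a) = x" using x by (metis imageE)
    then have "g a = Some x" using total[OF g(1)] by force
    then show ?thesis using inj_S[OF g(1) gy] y \<open>a \<in> A\<close> by blast
  qed
qed

text \<open>All idempotents of \<open>S\<close> are partial identities; \<open>D w\<close> is the domain of the least one that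
  fixes \<open>w\<close>.\<close>

definition D :: "'a \<Rightarrow> 'a set" where
  "D w = \<Inter>{A. Some |` A \<in> S \<and> w \<in> A}"

lemma D_least: "Some |` A \<in> S \<Longrightarrow> w \<in> A \<Longrightarrow> D w \<subseteq> A"
  by (auto simp: D_def)

lemma mem_D: "w \<in> D w"
  by (auto simp: D_def)

text \<open>Composing partial identities intersects their domains. The family is nonempty:
  semitransitivity at the pair \<open>w\<close>, \<open>w\<close> gives a map fixing
  \<open>w\<close>, and its idempotent power fixes \<open>w\<close> too.\<close>

lemma id_D_in_S:
  assumes "w \<in> X"
  shows "Some |` D w \<in> S"
proof -
  let ?F = "{A. Some |` A \<in> S \<and> w \<in> A}"
  have "?F \<subseteq> Pow X" using dom_S by fastforce
  then have fin: "finite ?F" using finite_X finite_subset by auto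
  obtain f where f: "f \<in> S" "f w = Some w" using semitrans assms by blast
  obtain A where "Some |` A \<in> S" "\<And>w. f w = Some w \<Longrightarrow> w \<in> A"
    by (rule idempotent_power[OF f(1)]) (rule that)
  then have ne: "?F \<noteq> {}" using f(2) by blast
  have "Some |` \<Inter>\<A> \<in> S" if "finite \<A>" "\<A> \<noteq> {}" "\<A> \<subseteq> ?F" for \<A>
    using that
  proof (induction rule: finite_ne_induct)
    case (insert A \<A>)
    then have "(Some |` A) \<circ>\<^sub>m (Some |` \<Inter>\<A>) \<in> S" by (intro comp_S) auto
    then show ?case by (simp add: restrict_Some_comp)
  qed auto
  then show ?thesis unfolding D_def using fin ne by blast
qed

lemma D_subset_X: "w \<in> X \<Longrightarrow> D w \<subseteq> X"
  using dom_S[OF id_D_in_S] by simp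

lemma D_mono: "w \<in> X \<Longrightarrow> v \<in> D w \<Longrightarrow> D v \<subseteq> D w"
  using D_least id_D_in_S by blast

section \<open>Normal maps: elements of \<open>e S e'\<close> for least idempotents \<open>e\<close>
  and \<open>e'\<close>\<close>

definition normal :: "'a \<Rightarrow> 'a \<Rightarrow> ('a \<rightharpoonup> 'a) \<Rightarrow> bool" where
  "normal w v f \<longleftrightarrow> f \<in> S \<and> f w = Some v \<and> dom f \<subseteq> D w \<and> ran f \<subseteq> D v"

lemma dom_ran_sandwich:
  "dom ((Some |` B) \<circ>\<^sub>m (f \<circ>\<^sub>m (Some |` A))) \<subseteq> A" "ran ((Some |` B) \<circ>\<^sub>m (f \<circ>\<^sub>m (Some |` A))) \<subseteq> B"
  by (auto simp: map_comp_def restrict_map_def ran_def split: option.splits if_splits)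

lemma normal_exists:
  assumes "reach w v"
  shows "\<exists>f. normal w v f"
proof -
  obtain f where f: "f \<in> S" "f w = Some v" using assms by (auto simp: reach_def)
  let ?f = "(Some |` D v) \<circ>\<^sub>m (f \<circ>\<^sub>m (Some |` D w))"
  have "?f \<in> S" using f reach_in_X[OF assms] by (simp add: comp_S id_D_in_S)
  moreover have "?f w = Some v" using f mem_D by (simp add: restrict_map_def)
  ultimately have "normal w v ?f" unfolding normal_def by (intro conjI dom_ran_sandwich)
  then show ?thesis by blast
qed

text \<open>A common map puts \<open>w\<close> into \<open>D w'\<close> and \<open>w'\<close> into
  \<open>D w\<close>, so each set contains the other; likewise for the targets. Maps of different
  type are thus different, which drives the counting.\<close>

lemma normal_type:
  assumes "normal w v f" "normal w' v' f"
  shows "D w = D w'" "D v = D v'"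
proof -
  have X: "w \<in> X" "v \<in> X" "w' \<in> X" "v' \<in> X" using assms in_X unfolding normal_def by blast+
  have "w \<in> D w'" "w' \<in> D w" "v \<in> D v'" "v' \<in> D v"
    using assms unfolding normal_def by (meson domI ranI subsetD)+
  then show "D w = D w'" "D v = D v'" using D_mono X by (meson subset_antisym)+
qed

text \<open>The preorder may hold in one direction only, so a link runs in an available direction,
  and its type is recovered only as an unordered pair.\<close>

definition link :: "'a \<Rightarrow> 'a \<Rightarrow> ('a \<rightharpoonup> 'a)" where
  "link w v = (SOME f. normal w v f \<or> normal v w f)"

lemma link_normal: "w \<in> X \<Longrightarrow> v \<in> X \<Longrightarrow> normal w v (link w v) \<or> normal v w (link w v)"
  unfolding link_def
  by (rule someI_ex[where P = "\<lambda>f. normal w v f \<or> normal v w f"])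
    (use reach_total[of w v] normal_exists[of w v] normal_exists[of v w] in blast)

lemma link_type:
  assumes "w \<in> X" "v \<in> X" "w' \<in> X" "v' \<in> X" "link w v = link w' v'"
  shows "{D w, D v} = {D w', D v'}"
proof -
  define f where "f = link w v"
  have "normal w v f \<or> normal v w f" using link_normal[OF assms(1,2)] by (simp add: f_def)
  moreover have "normal w' v' f \<or> normal v' w' f" using link_normal[OF assms(3,4)] assms(5) by (simp add: f_def)
  ultimately consider "normal w v f" "normal w' v' f" | "normal w v f" "normal v' w' f"
    | "normal v w f" "normal w' v' f" | "normal v w f" "normal v' w' f" by blast
  then have "(D w = D w' \<and> D v = D v') \<or> (D w = D v' \<and> D v = D w')"
    by cases (blast dest: normal_type)+
  then show ?thesis by (simp only: doubleton_eq_iff)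
qed

text \<open>Because the end classes differ, both links run in the same direction; the claim is then
  injectivity of the map or uniqueness of its value.\<close>

lemma link_inj:
  assumes "w \<in> X" "v \<in> X" "w' \<in> X" "D w \<noteq> D v" "D w' \<noteq> D v" "link w v = link w' v"
  shows "w = w'"
proof -
  define f where "f = link w v"
  have "normal w v f \<or> normal v w f" using link_normal[OF assms(1,2)] by (simp add: f_def)
  moreover have "normal w' v f \<or> normal v w' f"
    using link_normal[OF assms(3,2)] assms(6) by (simp add: f_def)
  ultimately consider "normal w v f" "normal w' v f" | "normal v w f" "normal v w' f"
    using normal_type[of w v f v w'] normal_type[of v w f w' v] assms(4,5) by auto
  then show ?thesis
  proof cases
    case 1 then show ?thesis unfolding normal_def using inj_S by blast
  next
    case 2 then show ?thesis by (simp add: normal_def)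
  qed
qed

section \<open>Counting maps within a class and between classes\<close>

definition dclass :: "'a \<Rightarrow> 'a set" where
  "dclass w = {v \<in> X. D v = D w}"

definition dtop :: "'a set \<Rightarrow> 'a" where
  "dtop A = (SOME t. t \<in> X \<and> D t = A \<and> (\<forall>v\<in>X. D v = A \<longrightarrow> reach t v))"

lemma dtop:
  assumes "w \<in> X"
  shows "dtop (D w) \<in> X" "D (dtop (D w)) = D w" "\<And>v. v \<in> X \<Longrightarrow> D v = D w \<Longrightarrow> reach (dtop (D w)) v"
proof -
  have "dclass w \<subseteq> X" "dclass w \<noteq> {}" using assms by (auto simp: dclass_def)
  then obtain t where "t \<in> dclass w" "\<And>v. v \<in> dclass w \<Longrightarrow> reach t v"
    by (rule top_exists) (rule that)
  then have "\<exists>t. t \<in> X \<and> D t = D w \<and> (\<forall>v\<in>X. D v = D w \<longrightarrow> reach t v)" by (auto simp: dclass_def)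
  then have "dtop (D w) \<in> X \<and> D (dtop (D w)) = D w \<and> (\<forall>v\<in>X. D v = D w \<longrightarrow> reach (dtop (D w)) v)"
    unfolding dtop_def by (rule someI_ex)
  then show "dtop (D w) \<in> X" "D (dtop (D w)) = D w" "\<And>v. v \<in> X \<Longrightarrow> D v = D w \<Longrightarrow> reach (dtop (D w)) v"
    by auto
qed

text \<open>Taking the top of the class as source guarantees that such a map exists, and
  \<open>w\<close> is recovered as its value there.\<close>

definition diag :: "'a \<Rightarrow> ('a \<rightharpoonup> 'a)" where
  "diag w = (SOME f. normal (dtop (D w)) w f)"

lemma diag_normal: "w \<in> X \<Longrightarrow> normal (dtop (D w)) w (diag w)"
  unfolding diag_def
  by (rule someI_ex[where P = "normal (dtop (D w)) w"], rule normal_exists, rule dtop(3)) auto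

lemma inj_on_diag: "inj_on diag X"
proof (rule inj_onI)
  fix w w' assume w: "w \<in> X" "w' \<in> X" "diag w = diag w'"
  then have n: "normal (dtop (D w)) w (diag w)" "normal (dtop (D w')) w' (diag w)"
    using diag_normal[of w] diag_normal[of w'] by simp_all
  then have "D w = D w'" by (rule normal_type(2))
  then show "w = w'" using n by (simp add: normal_def)
qed

lemma diag_neq_link:
  assumes "u \<in> X" "w \<in> X" "v \<in> X" "D w \<noteq> D v"
  shows "diag u \<noteq> link w v"
proof
  assume eq: "diag u = link w v"
  let ?t = "dtop (D u)"
  have n: "normal ?t u (diag u)" by (rule diag_normal[OF assms(1)])
  have t: "D ?t = D u" by (rule dtop(2)[OF assms(1)])
  have "normal w v (diag u) \<or> normal v w (diag u)"
    unfolding eq by (rule link_normal[OF assms(2,3)])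
  then show False
  proof
    assume "normal w v (diag u)"
    from normal_type[OF n this] t assms(4) show False by metis
  next
    assume "normal v w (diag u)"
    from normal_type[OF n this] t assms(4) show False by metis
  qed
qed

lemma link_in_S: "w \<in> X \<Longrightarrow> v \<in> X \<Longrightarrow> link w v \<in> S - {Map.empty}"
  using link_normal[of w v] unfolding normal_def by fastforce

lemma diag_in_S: "w \<in> X \<Longrightarrow> diag w \<in> S - {Map.empty}"
  using diag_normal[of w] unfolding normal_def by fastforce

text \<open>Three families are kept apart by the classes at their ends: one diagonal map per point,
  one link to \<open>x\<close> per point outside its class, one link to \<open>y\<close> per point
  of \<open>A\<close>. The summand 1 counts the empty map.\<close>

lemma card_ge_star:
  assumes x: "x \<in> X" and y: "y \<in> X" and A: "A \<subseteq> dclass z"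
    and ne: "A \<noteq> {} \<Longrightarrow> D y \<noteq> D x \<and> D z \<noteq> D x \<and> D y \<noteq> D z"
  shows "2 * card X - card (dclass x) + card A + 1 \<le> card S"
proof -
  let ?B = "X - dclass x"
  have sub: "?B \<subseteq> X" "A \<subseteq> X" "dclass x \<subseteq> X" using A by (auto simp: dclass_def)
  have fin: "finite ?B" "finite A" using finite_X sub finite_subset by auto
  have DB: "D w \<noteq> D x" if "w \<in> ?B" for w using that by (auto simp: dclass_def)
  have DA: "D w = D z" "D w \<noteq> D x" "D w \<noteq> D y" "D y \<noteq> D x" if "w \<in> A" for w
    using that A ne by (auto simp: dclass_def)
  have injB: "inj_on (\<lambda>w. link w x) ?B"
    using link_inj[OF _ x] DB by (intro inj_onI) auto
  have injA: "inj_on (\<lambda>w. link w y) A"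
    using link_inj[OF _ y] DA sub(2) by (intro inj_onI) (auto simp: subset_iff)
  have d1: "diag ` X \<inter> (\<lambda>w. link w x) ` ?B = {}"
    using diag_neq_link[OF _ _ x] DB sub(1) by blast
  have d2: "diag ` X \<inter> (\<lambda>w. link w y) ` A = {}"
    using diag_neq_link[OF _ _ y] DA(3) sub(2) by blast
  have d3: "(\<lambda>w. link w x) ` ?B \<inter> (\<lambda>w. link w y) ` A = {}"
  proof -
    have "link w x \<noteq> link v y" if "w \<in> ?B" "v \<in> A" for w v
    proof
      assume "link w x = link v y"
      then have "{D w, D x} = {D v, D y}" using that x y sub by (intro link_type) blast+
      then show False using DA(2,4)[OF that(2)] by blast
    qed
    then show ?thesis by blast
  qed
  let ?U = "diag ` X \<union> (\<lambda>w. link w x) ` ?B \<union> (\<lambda>w. link w y) ` A"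
  have "card ?U = card X + card ?B + card A"
  proof -
    have "card ?U = card (diag ` X \<union> (\<lambda>w. link w x) ` ?B) + card ((\<lambda>w. link w y) ` A)"
      using d2 d3 finite_X fin by (intro card_Un_disjoint) auto
    also have "card (diag ` X \<union> (\<lambda>w. link w x) ` ?B) = card (diag ` X) + card ((\<lambda>w. link w x) ` ?B)"
      using d1 finite_X by (intro card_Un_disjoint) auto
    finally show ?thesis using injA injB inj_on_diag by (simp add: card_image)
  qed
  moreover have "card ?B = card X - card (dclass x)"
    using sub finite_X by (intro card_Diff_subset) (auto intro: finite_subset)
  moreover have "card (dclass x) \<le> card X" by (rule card_mono[OF finite_X sub(3)])
  moreover have "?U \<subseteq> S - {Map.empty}"
  proof (intro Un_least image_subsetI)
    show "diag w \<in> S - {Map.empty}" if "w \<in> X" for w by (rule diag_in_S[OF that])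
    show "link w x \<in> S - {Map.empty}" if "w \<in> ?B" for w using that by (intro link_in_S x) auto
    show "link w y \<in> S - {Map.empty}" if "w \<in> A" for w using that sub(2) by (intro link_in_S y) auto
  qed
  then have "card ?U \<le> card (S - {Map.empty})" using finite_S by (intro card_mono) auto
  moreover have "card (S - {Map.empty}) + 1 = card S"
    using empty_in_S finite_S by (metis Suc_eq_plus1 card_Suc_Diff1)
  ultimately show ?thesis by linarith
qed

section \<open>Cells of mutually reachable points\<close>

definition eqv :: "'a \<Rightarrow> 'a \<Rightarrow> bool" where
  "eqv w v \<longleftrightarrow> reach w v \<and> reach v w"

lemma eqv_sym: "eqv w v \<Longrightarrow> eqv v w"
  by (simp add: eqv_def)

lemma eqv_trans: "eqv u v \<Longrightarrow> eqv v w \<Longrightarrow> eqv u w"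
  unfolding eqv_def using reach_trans by blast

lemma eqv_refl: "w \<in> X \<Longrightarrow> eqv w w"
  by (simp add: eqv_def reach_refl)

lemma eqv_in_X: "eqv w v \<Longrightarrow> w \<in> X \<and> v \<in> X"
  unfolding eqv_def using reach_in_X by blast

text \<open>\<open>f\<close> never raises \<open>reached\<close>, while permuting \<open>A\<close>
  leaves the sum of \<open>reached\<close> over \<open>A\<close> unchanged; hence no value drops
  strictly.\<close>

lemma reach_back_if_permutes:
  assumes f: "f \<in> S" "dom f = A" "ran f = A" "f a = Some b"
  shows "reach b a"
proof (rule ccontr)
  assume nb: "\<not> reach b a"
  let ?h = "\<lambda>x. the (f x)"
  have fin: "finite A" using f dom_S finite_X finite_subset by blast
  have h: "f x = Some (?h x)" if "x \<in> A" for x using that f(2) by auto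
  have inj: "inj_on ?h A"
  proof (rule inj_onI)
    fix x y assume xy: "x \<in> A" "y \<in> A" "?h x = ?h y"
    have "f x = Some (?h x)" "f y = Some (?h x)" using h[OF xy(1)] h[OF xy(2)] unfolding xy(3) .
    then show "x = y" by (rule inj_S[OF f(1)])
  qed
  have "?h ` A \<subseteq> A" using h f(3) by (auto intro: ranI)
  then have img: "?h ` A = A" using endo_inj_surj[OF fin _ inj] by blast
  have "(\<Sum>x\<in>A. reached (?h x)) < (\<Sum>x\<in>A. reached x)"
  proof (rule sum_strict_mono_ex1[OF fin])
    show "\<forall>x\<in>A. reached (?h x) \<le> reached x"
      using h f(1) reached_mono unfolding reach_def by blast
    have "a \<in> A" "?h a = b" using f by auto
    moreover have "reach a b" using f unfolding reach_def by blast
    ultimately show "\<exists>x\<in>A. reached (?h x) < reached x" using nb reached_strict by blast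
  qed
  moreover have "(\<Sum>x\<in>A. reached (?h x)) = (\<Sum>x\<in>A. reached x)"
    using sum.reindex[OF inj, of reached] img by simp
  ultimately show False by simp
qed

section \<open>Decreasing maps and the powers of their ideal\<close>

definition decreasing :: "('a \<rightharpoonup> 'a) set" where
  "decreasing = {f \<in> S. \<forall>w v. f w = Some v \<longrightarrow> \<not> reach v w}"

text \<open>The set of maps that are deep of level \<open>d\<close> is the \<open>d\<close>-th power of the ideal of
  decreasing maps.\<close>

inductive deep :: "nat \<Rightarrow> ('a \<rightharpoonup> 'a) \<Rightarrow> bool" where
  deep_base: "f \<in> S \<Longrightarrow> deep 0 f"
| deep_pre: "deep d f \<Longrightarrow> g \<in> S \<Longrightarrow> deep d (f \<circ>\<^sub>m g)"
| deep_post: "deep d f \<Longrightarrow> g \<in> S \<Longrightarrow> deep d (g \<circ>\<^sub>m f)"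
| deep_pre_decreasing: "deep d f \<Longrightarrow> g \<in> decreasing \<Longrightarrow> deep (Suc d) (f \<circ>\<^sub>m g)"
| deep_post_decreasing: "deep d f \<Longrightarrow> g \<in> decreasing \<Longrightarrow> deep (Suc d) (g \<circ>\<^sub>m f)"

lemma deep_in_S: "deep d f \<Longrightarrow> f \<in> S"
  by (induction rule: deep.induct) (auto simp: comp_S decreasing_def)

lemma decreasing_reached: "f \<in> decreasing \<Longrightarrow> f w = Some v \<Longrightarrow> reached v < reached w"
  using reached_strict unfolding decreasing_def reach_def by blast

lemma S_reached: "f \<in> S \<Longrightarrow> f w = Some v \<Longrightarrow> reached v \<le> reached w"
  using reached_mono unfolding reach_def by blast

text \<open>Every decreasing factor costs at least one unit of \<open>reached\<close>. This bounds
  the levels, so the greatest level in \<open>depth\<close> exists.\<close>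

lemma deep_bound: "deep d f \<Longrightarrow> f w = Some v \<Longrightarrow> reached v + d \<le> reached w"
proof (induction arbitrary: w v rule: deep.induct)
  case (deep_base f)
  then show ?case using S_reached by simp
next
  case (deep_pre d f g)
  then obtain u where u: "g w = Some u" "f u = Some v" by (auto simp: map_comp_Some_iff)
  then show ?case using deep_pre.IH[OF u(2)] S_reached[OF deep_pre.hyps(2) u(1)] by simp
next
  case (deep_post d f g)
  then obtain u where u: "f w = Some u" "g u = Some v" by (auto simp: map_comp_Some_iff)
  then show ?case using deep_post.IH[OF u(1)] S_reached[OF deep_post.hyps(2) u(2)] by simp
next
  case (deep_pre_decreasing d f g)
  then obtain u where u: "g w = Some u" "f u = Some v" by (auto simp: map_comp_Some_iff)
  then show ?case
    using deep_pre_decreasing.IH[OF u(2)] decreasing_reached[OF deep_pre_decreasing.hyps(2) u(1)] by simp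
next
  case (deep_post_decreasing d f g)
  then obtain u where u: "f w = Some u" "g u = Some v" by (auto simp: map_comp_Some_iff)
  then show ?case
    using deep_post_decreasing.IH[OF u(1)] decreasing_reached[OF deep_post_decreasing.hyps(2) u(2)] by simp
qed

definition depth :: "'a \<Rightarrow> 'a \<Rightarrow> nat" where
  "depth w v = (GREATEST d. \<exists>f. deep d f \<and> f w = Some v)"

lemma depth_attained:
  assumes "reach w v"
  shows "\<exists>f. deep (depth w v) f \<and> f w = Some v"
  unfolding depth_def
proof (rule GreatestI_ex_nat)
  show "\<exists>d f. deep d f \<and> f w = Some v" using assms deep_base unfolding reach_def by blast
  show "\<And>d. \<exists>f. deep d f \<and> f w = Some v \<Longrightarrow> d \<le> reached w" using deep_bound by fastforce
qed

lemma depth_ge: "deep d f \<Longrightarrow> f w = Some v \<Longrightarrow> d \<le> depth w v"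
  unfolding depth_def
proof (rule Greatest_le_nat)
  assume "deep d f" "f w = Some v"
  then show "\<exists>f. deep d f \<and> f w = Some v" by blast
  show "\<And>d. \<exists>f. deep d f \<and> f w = Some v \<Longrightarrow> d \<le> reached w" using deep_bound by fastforce
qed

text \<open>One point passing from the cell of \<open>w\<close> to the cell of \<open>v\<close>
  suffices; prescribing \<open>w\<close> and \<open>v\<close> themselves would not be stable under
  the units acting on the two cells.\<close>

definition deepest :: "'a \<Rightarrow> 'a \<Rightarrow> ('a \<rightharpoonup> 'a) set" where
  "deepest w v = {f. deep (depth w v) f \<and> dom f \<subseteq> D w \<and> ran f \<subseteq> D v \<and>
     (\<exists>w' v'. eqv w w' \<and> eqv v v' \<and> f w' = Some v')}"

lemma deepest_in_S: "deepest w v \<subseteq> S - {Map.empty}"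
  unfolding deepest_def using deep_in_S by fastforce

lemma deepest_nonempty:
  assumes "reach w v"
  shows "deepest w v \<noteq> {}"
proof -
  obtain f where f: "deep (depth w v) f" "f w = Some v" using depth_attained[OF assms] by blast
  have X: "w \<in> X" "v \<in> X" using reach_in_X[OF assms] by auto
  let ?f = "(Some |` D v) \<circ>\<^sub>m (f \<circ>\<^sub>m (Some |` D w))"
  have "deep (depth w v) ?f" using f(1) X by (intro deep_pre deep_post id_D_in_S)
  moreover have "?f w = Some v" using f mem_D by (simp add: restrict_map_def)
  then have "\<exists>w' v'. eqv w w' \<and> eqv v v' \<and> ?f w' = Some v'" using X eqv_refl by blast
  ultimately have "?f \<in> deepest w v"
    unfolding deepest_def by (intro CollectI conjI dom_ran_sandwich)
  then show ?thesis by blast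
qed

definition cell :: "'a \<Rightarrow> 'a set" where
  "cell w = {v. eqv w v}"

lemma cell_subset_X: "cell w \<subseteq> X"
  using eqv_in_X by (auto simp: cell_def)

end

section \<open>Disjoint classes of different sizes\<close>

locale semitransitive_pinj_disjoint = semitransitive_pinj +
  assumes D_disjoint: "w \<in> X \<Longrightarrow> v \<in> D w \<Longrightarrow> D v = D w"
    and D_card: "w \<in> X \<Longrightarrow> v \<in> X \<Longrightarrow> card (D w) = card (D v) \<Longrightarrow> D w = D v"
begin

text \<open>Returning from \<open>v\<close> to \<open>w\<close> gives a composite fixing
  \<open>w\<close>; its idempotent power fixes all of \<open>D w\<close>, so \<open>f\<close> is
  defined there. The composite in the other order shows that \<open>f\<close> is onto
  \<open>D b\<close>. Equal sizes then identify the two classes.\<close>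

lemma permutes_if_fixes_cell:
  assumes f: "f \<in> S" "dom f \<subseteq> D a" "ran f \<subseteq> D b" and ab: "a \<in> X" "b \<in> X"
    and wv: "f w = Some v" "reach v w"
  shows "D b = D a" "dom f = D a" "ran f = D a"
proof -
  have Dw: "D w = D a" using f(2) wv(1) by (intro D_disjoint[OF ab(1)]) auto
  have Dv: "D v = D b" using f(3) wv(1) by (intro D_disjoint[OF ab(2)]) (auto intro: ranI)
  obtain g where g: "g \<in> S" "g v = Some w" using wv(2) by (auto simp: reach_def)
  have "(g \<circ>\<^sub>m f) w = Some w" using g wv by simp
  moreover obtain A where A: "Some |` A \<in> S" "A \<subseteq> dom (g \<circ>\<^sub>m f)" "\<And>u. (g \<circ>\<^sub>m f) u = Some u \<Longrightarrow> u \<in> A"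
    by (rule idempotent_power[OF comp_S[OF f(1) g(1)]]) (rule that)
  ultimately have "D w \<subseteq> A" using D_least by blast
  also have "A \<subseteq> dom f" using A(2) dom_map_comp_subset by (rule subset_trans)
  finally have 1: "dom f = D a" using Dw f(2) by blast
  have "(f \<circ>\<^sub>m g) v = Some v" using g wv by simp
  moreover obtain B where B: "Some |` B \<in> S" "B \<subseteq> ran (f \<circ>\<^sub>m g)" "\<And>u. (f \<circ>\<^sub>m g) u = Some u \<Longrightarrow> u \<in> B"
    by (rule idempotent_power[OF comp_S[OF g(1) f(1)]]) (rule that)
  ultimately have "D v \<subseteq> B" using D_least by blast
  also have "B \<subseteq> ran f" using B(2) ran_map_comp_subset by (rule subset_trans)
  finally have 2: "ran f = D b" using Dv f(3) by blast
  have "card (D b) = card (D a)" using card_ran[OF f(1)] 1 2 by simp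
  then show "D b = D a" by (rule D_card[OF ab(2,1)])
  then show "dom f = D a" "ran f = D a" using 1 2 by auto
qed

text \<open>The maps \<open>g\<close> are units of the local monoid on \<open>D u\<close>: they act
  transitively on its cells and preserve each of them.\<close>

lemma eqv_permutation:
  assumes "eqv u v"
  obtains g where "g \<in> S" "g u = Some v" "dom g = D u" "ran g = D u" "D v = D u"
    "\<And>a b. g a = Some b \<Longrightarrow> eqv a b"
proof -
  have X: "u \<in> X" "v \<in> X" and r: "reach u v" "reach v u" using assms eqv_in_X by (auto simp: eqv_def)
  obtain g where g: "g \<in> S" "g u = Some v" "dom g \<subseteq> D u" "ran g \<subseteq> D v"
    using normal_exists[OF r(1)] unfolding normal_def by blast
  note p = permutes_if_fixes_cell[OF g(1,3,4) X g(2) r(2)]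
  have "eqv a b" if "g a = Some b" for a b
    unfolding eqv_def reach_def[of a b]
    using that g(1) reach_back_if_permutes[OF g(1) p(2,3) that] by blast
  then show ?thesis using that g p by blast
qed

lemma eqv_same_D: "eqv u v \<Longrightarrow> D v = D u"
  by (erule eqv_permutation)

text \<open>A normal map sending some point into its own cell would permute the class, and then
  \<open>v\<close> would reach \<open>w\<close>.\<close>

lemma decreasing_exists:
  assumes "reach w v" "\<not> reach v w"
  shows "\<exists>f\<in>decreasing. f w = Some v"
proof -
  have X: "w \<in> X" "v \<in> X" using reach_in_X assms by auto
  obtain f where f: "f \<in> S" "f w = Some v" "dom f \<subseteq> D w" "ran f \<subseteq> D v"
    using normal_exists[OF assms(1)] unfolding normal_def by blast
  have "\<not> reach b a" if ab: "f a = Some b" for a b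
  proof
    assume "reach b a"
    note p = permutes_if_fixes_cell[OF f(1,3,4) X ab this]
    show False using reach_back_if_permutes[OF f(1) p(2,3) f(2)] assms(2) by blast
  qed
  then have "f \<in> decreasing" using f(1) by (auto simp: decreasing_def)
  then show ?thesis using f(2) by blast
qed

text \<open>A map between cells that lie weakly inside the interval from \<open>x\<close> down to \<open>y\<close> could otherwise be
  extended by a decreasing map at one end to a deeper map from \<open>x\<close> to \<open>y\<close>.\<close>

lemma deepest_extremal:
  assumes f: "f \<in> deepest x y" "f u = Some v" and r: "reach x u" "reach v y"
  shows "eqv x u" "eqv v y"
proof -
  have d: "deep (depth x y) f" using f by (simp add: deepest_def)
  obtain g where g: "g \<in> S" "g x = Some u" using r(1) by (auto simp: reach_def)
  obtain h where h: "h \<in> S" "h v = Some y" using r(2) by (auto simp: reach_def)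
  show "eqv x u"
  proof (rule ccontr)
    assume "\<not> eqv x u"
    then obtain g' where g': "g' \<in> decreasing" "g' x = Some u"
      using decreasing_exists r unfolding eqv_def by blast
    have "deep (Suc (depth x y)) (h \<circ>\<^sub>m (f \<circ>\<^sub>m g'))" using d g' h by (intro deep_post deep_pre_decreasing)
    moreover have "(h \<circ>\<^sub>m (f \<circ>\<^sub>m g')) x = Some y" using f g' h by simp
    ultimately show False using depth_ge by fastforce
  qed
  show "eqv v y"
  proof (rule ccontr)
    assume "\<not> eqv v y"
    then obtain h' where h': "h' \<in> decreasing" "h' v = Some y"
      using decreasing_exists r unfolding eqv_def by blast
    have "deep (Suc (depth x y)) (h' \<circ>\<^sub>m (f \<circ>\<^sub>m g))" using d g h' by (intro deep_pre deep_post_decreasing)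
    moreover have "(h' \<circ>\<^sub>m (f \<circ>\<^sub>m g)) x = Some y" using f g h' by simp
    ultimately show False using depth_ge by fastforce
  qed
qed

text \<open>Units of the source class act by precomposition and move \<open>pos\<close> transitively
  through the cell of \<open>w\<close>.\<close>

lemma card_source_cell_dvd:
  "card (cell w) dvd card (deepest w v)"
proof -
  \<comment> \<open>\<open>Y f\<close> collects the values in the target cell attained from the
    source cell. Precomposition with units preserves it, hence also the chosen value
    \<open>c f\<close>, while the preimage \<open>pos f\<close> moves with the unit.\<close>
  define Y where "Y f = {z. eqv v z \<and> (\<exists>u. eqv w u \<and> f u = Some z)}" for f
  define c where "c f = (SOME z. z \<in> Y f)" for f
  define pos where "pos f = (SOME u. eqv w u \<and> f u = Some (c f))" for f
  have pos: "eqv w (pos f)" "f (pos f) = Some (c f)" if f: "f \<in> deepest w v" for f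
  proof -
    have "\<exists>z. z \<in> Y f" using f by (auto simp: deepest_def Y_def)
    then have "c f \<in> Y f" unfolding c_def by (rule someI_ex)
    then have "\<exists>u. eqv w u \<and> f u = Some (c f)" by (auto simp: Y_def)
    then have "eqv w (pos f) \<and> f (pos f) = Some (c f)" unfolding pos_def by (rule someI_ex)
    then show "eqv w (pos f)" "f (pos f) = Some (c f)" by auto
  qed
  show ?thesis
  proof (rule card_dvd_card_if_transitive)
    show "finite (deepest w v)" using deepest_in_S finite_S finite_subset by blast
    show "finite (cell w)" by (rule finite_subset[OF cell_subset_X finite_X])
    show "pos f \<in> cell w" if "f \<in> deepest w v" for f using pos that by (simp add: cell_def)
    fix u u' assume u: "u \<in> cell w" "u' \<in> cell w"
    then have wu: "eqv w u" "eqv w u'" by (auto simp: cell_def)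
    then have "eqv u' u" using eqv_trans eqv_sym by blast
    then obtain g where g: "g \<in> S" "g u' = Some u" "dom g = D u'" "ran g = D u'"
      and ge: "\<And>a b. g a = Some b \<Longrightarrow> eqv a b"
      by (rule eqv_permutation) (rule that)
    have Du: "D u' = D w" using eqv_same_D[OF wu(2)] .
    have onto: "\<exists>a. g a = Some b" if "b \<in> D w" for b
      using that g(4) Du by (auto simp: ran_def)
    have cellD: "b \<in> D w" if "eqv w b" for b using eqv_same_D[OF that] mem_D by metis
    have YY: "Y (f \<circ>\<^sub>m g) = Y f" for f
    proof
      show "Y (f \<circ>\<^sub>m g) \<subseteq> Y f"
        unfolding Y_def using ge eqv_trans by (fastforce simp: map_comp_Some_iff)
      show "Y f \<subseteq> Y (f \<circ>\<^sub>m g)"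
      proof
        fix z assume "z \<in> Y f"
        then obtain b where b: "eqv v z" "eqv w b" "f b = Some z" by (auto simp: Y_def)
        obtain a where a: "g a = Some b" using onto cellD b by blast
        have "eqv w a" using ge[OF a] b(2) eqv_sym eqv_trans by blast
        then show "z \<in> Y (f \<circ>\<^sub>m g)" using a b by (auto simp: Y_def map_comp_Some_iff)
      qed
    qed
    have mem: "f \<circ>\<^sub>m g \<in> deepest w v" if f: "f \<in> deepest w v" for f
    proof -
      have "deep (depth w v) (f \<circ>\<^sub>m g)" using f g by (auto simp: deepest_def intro: deep_pre)
      moreover have "dom (f \<circ>\<^sub>m g) \<subseteq> D w" using g(3) Du dom_map_comp_subset by metis
      moreover have "ran (f \<circ>\<^sub>m g) \<subseteq> D v" using f ran_map_comp_subset unfolding deepest_def by fast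
      moreover have "Y (f \<circ>\<^sub>m g) \<noteq> {}" unfolding YY using f by (auto simp: deepest_def Y_def)
      ultimately show ?thesis unfolding deepest_def Y_def by blast
    qed
    show "\<exists>t. inj_on t (deepest w v) \<and> t ` deepest w v \<subseteq> deepest w v \<and>
      (\<forall>f\<in>deepest w v. pos f = u \<longrightarrow> pos (t f) = u')"
    proof (intro exI conjI ballI impI)
      show "inj_on (\<lambda>f. f \<circ>\<^sub>m g) (deepest w v)"
      proof (rule inj_onI, rule ext)
        fix f1 f2 b assume f: "f1 \<in> deepest w v" "f2 \<in> deepest w v" "f1 \<circ>\<^sub>m g = f2 \<circ>\<^sub>m g"
        show "f1 b = f2 b"
        proof (cases "b \<in> D w")
          case True
          then obtain a where "g a = Some b" using onto by blast
          then show ?thesis using fun_cong[OF f(3), of a] by simp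
        next
          case False
          then have "b \<notin> dom f1" "b \<notin> dom f2" using f by (auto simp: deepest_def)
          then show ?thesis by (simp add: domIff)
        qed
      qed
      show "(\<lambda>f. f \<circ>\<^sub>m g) ` deepest w v \<subseteq> deepest w v" using mem by blast
      fix f assume f: "f \<in> deepest w v" "pos f = u"
      have "c (f \<circ>\<^sub>m g) = c f" by (simp add: c_def YY)
      then have "(f \<circ>\<^sub>m g) (pos (f \<circ>\<^sub>m g)) = Some (c f)" using pos(2)[OF mem[OF f(1)]] by simp
      moreover have "(f \<circ>\<^sub>m g) u' = Some (c f)" using pos(2)[OF f(1)] f(2) g(2) by simp
      moreover have "f \<circ>\<^sub>m g \<in> S" using mem[OF f(1)] deepest_in_S by blast
      ultimately show "pos (f \<circ>\<^sub>m g) = u'" using inj_S by blast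
    qed
  qed
qed

text \<open>Dually, units of the target class act by postcomposition: the set \<open>Y\<close> of
  source points sent into the target cell is invariant, and \<open>pos\<close> is the image of a
  chosen one.\<close>

lemma card_target_cell_dvd:
  "card (cell v) dvd card (deepest w v)"
proof -
  define Y where "Y f = {u. eqv w u \<and> (\<exists>z. eqv v z \<and> f u = Some z)}" for f
  define c where "c f = (SOME u. u \<in> Y f)" for f
  define pos where "pos f = the (f (c f))" for f
  have pos: "eqv v (pos f)" "f (c f) = Some (pos f)" if f: "f \<in> deepest w v" for f
  proof -
    have "\<exists>u. u \<in> Y f" using f by (auto simp: deepest_def Y_def)
    then have "c f \<in> Y f" unfolding c_def by (rule someI_ex)
    then show "eqv v (pos f)" "f (c f) = Some (pos f)" by (auto simp: Y_def pos_def)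
  qed
  show ?thesis
  proof (rule card_dvd_card_if_transitive)
    show "finite (deepest w v)" using deepest_in_S finite_S finite_subset by blast
    show "finite (cell v)" by (rule finite_subset[OF cell_subset_X finite_X])
    show "pos f \<in> cell v" if "f \<in> deepest w v" for f using pos that by (simp add: cell_def)
    fix u u' assume u: "u \<in> cell v" "u' \<in> cell v"
    then have vu: "eqv v u" "eqv v u'" by (auto simp: cell_def)
    then have "eqv u u'" using eqv_trans eqv_sym by blast
    then obtain g where g: "g \<in> S" "g u = Some u'" "dom g = D u" "ran g = D u"
      and ge: "\<And>a b. g a = Some b \<Longrightarrow> eqv a b"
      by (rule eqv_permutation) (rule that)
    have Du: "D u = D v" using eqv_same_D[OF vu(1)] .
    have total: "\<exists>b. g a = Some b" if "a \<in> D v" for a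
      using that g(3) Du by auto
    have cellD: "b \<in> D v" if "eqv v b" for b using eqv_same_D[OF that] mem_D by metis
    have YY: "Y (g \<circ>\<^sub>m f) = Y f" for f
    proof
      show "Y (g \<circ>\<^sub>m f) \<subseteq> Y f"
      proof
        fix a assume "a \<in> Y (g \<circ>\<^sub>m f)"
        then obtain z b where "eqv w a" "eqv v z" "f a = Some b" "g b = Some z"
          by (auto simp: Y_def map_comp_Some_iff)
        moreover from this have "eqv v b" using ge eqv_sym eqv_trans by blast
        ultimately show "a \<in> Y f" by (auto simp: Y_def)
      qed
      show "Y f \<subseteq> Y (g \<circ>\<^sub>m f)"
      proof
        fix a assume "a \<in> Y f"
        then obtain b where b: "eqv w a" "eqv v b" "f a = Some b" by (auto simp: Y_def)
        obtain z where z: "g b = Some z" using total cellD b by blast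
        have "eqv v z" using ge[OF z] b(2) eqv_trans by blast
        then show "a \<in> Y (g \<circ>\<^sub>m f)" using z b by (auto simp: Y_def map_comp_Some_iff)
      qed
    qed
    have mem: "g \<circ>\<^sub>m f \<in> deepest w v" if f: "f \<in> deepest w v" for f
    proof -
      have "deep (depth w v) (g \<circ>\<^sub>m f)" using f g by (auto simp: deepest_def intro: deep_post)
      moreover have "dom (g \<circ>\<^sub>m f) \<subseteq> D w" using f dom_map_comp_subset unfolding deepest_def by fast
      moreover have "ran (g \<circ>\<^sub>m f) \<subseteq> D v" using g(4) Du ran_map_comp_subset by metis
      moreover have "Y (g \<circ>\<^sub>m f) \<noteq> {}" unfolding YY using f by (auto simp: deepest_def Y_def)
      ultimately show ?thesis unfolding deepest_def Y_def by blast
    qed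
    show "\<exists>t. inj_on t (deepest w v) \<and> t ` deepest w v \<subseteq> deepest w v \<and>
      (\<forall>f\<in>deepest w v. pos f = u \<longrightarrow> pos (t f) = u')"
    proof (intro exI conjI ballI impI)
      show "inj_on (\<lambda>f. g \<circ>\<^sub>m f) (deepest w v)"
      proof (rule inj_onI, rule ext)
        fix f1 f2 a assume f: "f1 \<in> deepest w v" "f2 \<in> deepest w v" "g \<circ>\<^sub>m f1 = g \<circ>\<^sub>m f2"
        have r: "ran f1 \<subseteq> D v" "ran f2 \<subseteq> D v" using f by (auto simp: deepest_def)
        have "f1 a = Some b \<longleftrightarrow> f2 a = Some b" for b
        proof -
          have imp: "f2 a = Some b"
            if h: "f1 a = Some b" "ran f1 \<subseteq> D v" "g \<circ>\<^sub>m f1 = g \<circ>\<^sub>m f2" for f1 f2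
          proof -
            have "b \<in> D v" using h(1,2) by (auto intro: ranI)
            then obtain z where z: "g b = Some z" using total by blast
            then have "(g \<circ>\<^sub>m f2) a = Some z" using h(1) fun_cong[OF h(3), of a] by simp
            then obtain b' where "f2 a = Some b'" "g b' = Some z" by (auto simp: map_comp_Some_iff)
            then show ?thesis using inj_S[OF g(1) z] by simp
          qed
          show ?thesis using imp[of f1 f2] imp[of f2 f1] r f(3) by auto
        qed
        then show "f1 a = f2 a" by (metis not_Some_eq)
      qed
      show "(\<lambda>f. g \<circ>\<^sub>m f) ` deepest w v \<subseteq> deepest w v" using mem by blast
      fix f assume f: "f \<in> deepest w v" "pos f = u"
      have "c (g \<circ>\<^sub>m f) = c f" by (simp add: c_def YY)
      then show "pos (g \<circ>\<^sub>m f) = u'" using pos(2)[OF f(1)] f(2) g(2) by (simp add: pos_def)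
    qed
  qed
qed

lemma card_deepest_ge:
  assumes "reach w v"
  shows "lcm (card (cell w)) (card (cell v)) \<le> card (deepest w v)"
proof -
  have "finite (deepest w v)" using deepest_in_S finite_S finite_subset by blast
  then have "card (deepest w v) > 0" using deepest_nonempty[OF assms] by (simp add: card_gt_0_iff)
  moreover have "lcm (card (cell w)) (card (cell v)) dvd card (deepest w v)"
    by (intro lcm_least card_source_cell_dvd card_target_cell_dvd)
  ultimately show ?thesis by (rule dvd_imp_le[rotated])
qed

section \<open>Disjointness of the families of deepest maps\<close>

lemma deepest_type:
  assumes "f \<in> deepest w v" "f \<in> deepest w' v'" "w \<in> X" "v \<in> X" "w' \<in> X" "v' \<in> X"
  shows "D w = D w'" "D v = D v'"
proof -
  obtain a b where ab: "f a = Some b" using assms(1) by (auto simp: deepest_def)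
  have "a \<in> D w" "b \<in> D v" "a \<in> D w'" "b \<in> D v'"
    using ab assms(1,2) unfolding deepest_def by (auto intro: ranI)
  then show "D w = D w'" "D v = D v'" using D_disjoint assms by metis+
qed

text \<open>If \<open>w\<close> reaches \<open>w'\<close>, a value of \<open>f\<close> in the cell
  of \<open>w\<close> reaches \<open>w'\<close> too, so extremality for the pair \<open>x\<close>,
  \<open>w'\<close> places it in the cell of \<open>w'\<close>.\<close>

lemma deepest_same_source:
  assumes "f \<in> deepest x w" "f \<in> deepest x w'" "w \<in> X" "w' \<in> X"
  shows "eqv w w'"
proof -
  have "eqv w w'" if f: "f \<in> deepest x w" "f \<in> deepest x w'" and r: "reach w w'" for w w'
  proof -
    obtain a b where ab: "eqv x a" "eqv w b" "f a = Some b" using f(1) by (auto simp: deepest_def)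
    have "reach b w'" using ab(2) r reach_trans unfolding eqv_def by blast
    then have "eqv b w'" using deepest_extremal(2)[OF f(2) ab(3)] ab(1) unfolding eqv_def by blast
    then show ?thesis using ab(2) eqv_trans by blast
  qed
  then show ?thesis using assms reach_total eqv_sym by blast
qed

lemma deepest_same_target:
  assumes "f \<in> deepest w y" "f \<in> deepest w' y" "w \<in> X" "w' \<in> X"
  shows "eqv w w'"
proof -
  have "eqv w w'" if f: "f \<in> deepest w y" "f \<in> deepest w' y" and r: "reach w w'" for w w'
  proof -
    obtain a b where ab: "eqv w' a" "eqv y b" "f a = Some b" using f(2) by (auto simp: deepest_def)
    have "reach w a" using ab(1) r reach_trans unfolding eqv_def by blast
    then have "eqv w a" using deepest_extremal(1)[OF f(1) ab(3)] ab(2) unfolding eqv_def by blast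
    then show ?thesis using ab(1) eqv_trans eqv_sym by blast
  qed
  then show ?thesis using assms reach_total eqv_sym by blast
qed

text \<open>For a topmost \<open>x\<close> and a point \<open>y\<close> topmost in a different class, the deepest maps from \<open>x\<close> to each
  cell and those between \<open>y\<close> and each cell other than that of \<open>x\<close> form disjoint families.\<close>

lemma card_ge_cells:
  assumes two: "u0 \<in> X" "v0 \<in> X" "D u0 \<noteq> D v0"
  obtains g where "g dvd card X" "g < card X" "2 * card X - g + 1 \<le> card S"
proof -
  \<comment> \<open>Equivalent points have the same predicate \<open>eqv\<close>, hence the same
    choice, so \<open>C\<close> is a transversal of the cells.\<close>
  define rep where "rep w = (SOME v. eqv w v)" for w
  have rep: "eqv w (rep w)" if "w \<in> X" for w unfolding rep_def using eqv_refl[OF that] by (rule someI)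
  have rep_eq: "rep w = rep v" if "eqv w v" for w v
  proof -
    have "eqv w = eqv v" using that eqv_trans eqv_sym by blast
    then show ?thesis by (simp add: rep_def)
  qed
  define C where "C = rep ` X"
  have CX: "C \<subseteq> X" using rep eqv_in_X by (auto simp: C_def)
  have finC: "finite C" using finite_X by (simp add: C_def)
  have C_eq: "w = v" if wv: "w \<in> C" "v \<in> C" "eqv w v" for w v
  proof -
    obtain w0 v0 where "w0 \<in> X" "v0 \<in> X" "w = rep w0" "v = rep v0" using wv by (auto simp: C_def)
    then show ?thesis using rep rep_eq wv(3) by metis
  qed
  obtain x0 where x0: "x0 \<in> X" "\<And>v. v \<in> X \<Longrightarrow> reach x0 v"
    by (rule top_exists[OF subset_refl X_nonempty]) (rule that)
  define x where "x = rep x0"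
  have xC: "x \<in> C" using x0 by (simp add: x_def C_def)
  have x: "x \<in> X" using xC CX by auto
  have xtop: "reach x v" if "v \<in> X" for v
    using x0(2)[OF that] rep[OF x0(1)] reach_trans unfolding x_def eqv_def by blast
  obtain y1 where y1: "y1 \<in> X" "D y1 \<noteq> D x" using two by metis
  define y where "y = rep (dtop (D y1))"
  have yC: "y \<in> C" using dtop(1)[OF y1(1)] by (simp add: y_def C_def)
  have y: "y \<in> X" using yC CX by auto
  have yeq: "eqv (dtop (D y1)) y" unfolding y_def by (rule rep[OF dtop(1)[OF y1(1)]])
  have Dy: "D y = D y1" using eqv_same_D[OF yeq] dtop(2)[OF y1(1)] by simp
  have Dxy: "D y \<noteq> D x" using Dy y1(2) by simp
  have ytop: "reach y v" if "v \<in> X" "D v = D y" for v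
    using dtop(3)[OF y1(1) that(1)] that(2) Dy yeq reach_trans unfolding eqv_def by metis
  have xy: "x \<noteq> y" using Dxy by auto
  define P where "P w = deepest x w" for w
  \<comment> \<open>\<open>y\<close> need not reach every point, so the direction depends on
    \<open>w\<close>. The index \<open>x\<close> is left out below, as \<open>deepest x y\<close> is
    already counted as \<open>P y\<close>.\<close>
  define R where "R w = (if reach y w then deepest y w else deepest w y)" for w
  have PP: "P w \<inter> P v = {}" if "w \<in> C" "v \<in> C" "w \<noteq> v" for w v
    using deepest_same_source[of _ x w v] C_eq that CX unfolding P_def by blast
  have PR: "P w \<inter> R v = {}" if w: "w \<in> C" and v: "v \<in> C - {x}" for w v
  proof (rule ccontr)
    have wX: "w \<in> X" and vX: "v \<in> X" using w v CX by auto
    assume "P w \<inter> R v \<noteq> {}"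
    then obtain f where f: "f \<in> deepest x w" "f \<in> R v" by (auto simp: P_def)
    show False
    proof (cases "reach y v")
      case True
      then have "f \<in> deepest y v" using f(2) by (simp add: R_def)
      then show False using deepest_type(1)[OF f(1) _ x wX y vX] Dxy by simp
    next
      case False
      then have fv: "f \<in> deepest v y" using f(2) by (simp add: R_def)
      \<comment> \<open>As \<open>w\<close> lies in the class of \<open>y\<close>, it is reached
        from \<open>y\<close>, and extremality of \<open>f\<close> for the pair \<open>x\<close>,
        \<open>w\<close> forces \<open>v\<close> into the cell of \<open>x\<close>.\<close>
      have Dw: "D w = D y" by (rule deepest_type(2)[OF f(1) fv x wX vX y])
      obtain a b where ab: "eqv v a" "eqv y b" "f a = Some b" using fv by (auto simp: deepest_def)
      have "reach x a" using ab(1) eqv_in_X xtop by blast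
      moreover have "reach b w"
        using ytop[OF wX Dw] ab(2) reach_trans unfolding eqv_def by blast
      ultimately have "eqv x a" by (rule deepest_extremal(1)[OF f(1) ab(3)])
      then have "eqv v x" using ab(1) eqv_sym eqv_trans by blast
      then show False using C_eq[of v x] v xC by auto
    qed
  qed
  have RR: "R w \<inter> R v = {}" if "w \<in> C - {x}" "v \<in> C - {x}" "w \<noteq> v" for w v
  proof (rule ccontr)
    have wX: "w \<in> X" and vX: "v \<in> X" using that CX by auto
    assume "R w \<inter> R v \<noteq> {}"
    then obtain f where f: "f \<in> R w" "f \<in> R v" by auto
    \<comment> \<open>Such a map would put \<open>b\<close> into the class of \<open>y\<close>, all
      of which is reached from \<open>y\<close>.\<close>
    have mixed: False if "f \<in> deepest y a" "f \<in> deepest b y" "\<not> reach y b" "a \<in> X" "b \<in> X" for a b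
      using deepest_type(1)[OF that(1,2) y that(4,5) y] ytop[OF that(5)] that(3) by simp
    have "eqv w v"
    proof (cases "reach y w"; cases "reach y v")
      assume "reach y w" "reach y v"
      then show ?thesis using f deepest_same_source wX vX by (simp add: R_def)
    next
      assume "\<not> reach y w" "\<not> reach y v"
      then show ?thesis using f deepest_same_target wX vX by (simp add: R_def)
    next
      assume "reach y w" "\<not> reach y v"
      then show ?thesis using f mixed[of w v] wX vX by (simp add: R_def)
    next
      assume "\<not> reach y w" "reach y v"
      then show ?thesis using f mixed[of v w] wX vX by (simp add: R_def)
    qed
    then show False using C_eq that by blast
  qed
  have finP: "finite (P w)" "finite (R w)" for w
    using finite_subset[OF deepest_in_S] finite_S by (auto simp: P_def R_def)
  let ?U = "(\<Union>w\<in>C. P w) \<union> (\<Union>w\<in>C-{x}. R w)"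
  have "card ?U = card (\<Union>w\<in>C. P w) + card (\<Union>w\<in>C-{x}. R w)"
  proof (rule card_Un_disjoint)
    show "finite (\<Union>w\<in>C. P w)" "finite (\<Union>w\<in>C-{x}. R w)" using finC finP by auto
    show "(\<Union>w\<in>C. P w) \<inter> (\<Union>w\<in>C-{x}. R w) = {}" using PR by blast
  qed
  also have "card (\<Union>w\<in>C. P w) = (\<Sum>w\<in>C. card (P w))"
    using PP finC finP by (intro card_UN_disjoint) auto
  also have "card (\<Union>w\<in>C-{x}. R w) = (\<Sum>w\<in>C-{x}. card (R w))"
    using RR finC finP by (intro card_UN_disjoint) auto
  finally have cardU: "card ?U = (\<Sum>w\<in>C. card (P w)) + (\<Sum>w\<in>C-{x}. card (R w))" .
  define m where "m w = card (cell w)" for w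
  have "(\<Sum>w\<in>C. lcm (m x) (m w)) \<le> (\<Sum>w\<in>C. card (P w))"
    unfolding P_def m_def using xtop CX by (intro sum_mono card_deepest_ge) auto
  moreover have "(\<Sum>w\<in>C-{x}. lcm (m y) (m w)) \<le> (\<Sum>w\<in>C-{x}. card (R w))"
  proof (rule sum_mono)
    fix w assume "w \<in> C - {x}"
    then have "reach y w \<or> reach w y" using reach_total y CX by blast
    then show "lcm (m y) (m w) \<le> card (R w)"
      unfolding R_def m_def using card_deepest_ge[of y w] card_deepest_ge[of w y]
      by (auto simp: lcm.commute)
  qed
  moreover have "card ?U + 1 \<le> card S"
  proof -
    have "?U \<subseteq> S - {Map.empty}"
      using deepest_in_S unfolding P_def R_def by (intro Un_least UN_least) auto
    then have "card ?U \<le> card (S - {Map.empty})" using finite_S by (intro card_mono) auto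
    then show ?thesis using empty_in_S finite_S by (metis Suc_eq_plus1 Suc_le_mono card_Suc_Diff1)
  qed
  ultimately have lower: "(\<Sum>w\<in>C. lcm (m x) (m w)) + (\<Sum>w\<in>C-{x}. lcm (m y) (m w)) + 1 \<le> card S"
    using cardU by linarith
  have "X = (\<Union>w\<in>C. cell w)"
    using rep eqv_sym cell_subset_X by (fastforce simp: C_def cell_def)
  then have "card X = card (\<Union>w\<in>C. cell w)" by simp
  also have "\<dots> = (\<Sum>w\<in>C. m w)"
    unfolding m_def
  proof (rule card_UN_disjoint[OF finC])
    show "\<forall>w\<in>C. finite (cell w)" using finite_subset[OF cell_subset_X finite_X] by blast
    show "\<forall>w\<in>C. \<forall>v\<in>C. w \<noteq> v \<longrightarrow> cell w \<inter> cell v = {}"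
      unfolding cell_def using C_eq eqv_sym eqv_trans by blast
  qed
  finally have cardX: "card X = (\<Sum>w\<in>C. m w)" .
  have mpos: "m w > 0" if "w \<in> C" for w
  proof -
    have "w \<in> cell w" using eqv_refl that CX by (auto simp: cell_def)
    then show ?thesis
      unfolding m_def using finite_subset[OF cell_subset_X finite_X] by (auto simp: card_gt_0_iff)
  qed
  obtain g where g: "g dvd (\<Sum>w\<in>C. m w)" "g < (\<Sum>w\<in>C. m w)"
    "2 * (\<Sum>w\<in>C. m w) \<le> (\<Sum>w\<in>C. lcm (m x) (m w)) + (\<Sum>w\<in>C-{x}. lcm (m y) (m w)) + g"
    by (rule sum_lcm_lower_bound[OF finC xC yC xy mpos]) (auto intro: that)
  show ?thesis
  proof (rule that)
    show "g dvd card X" "g < card X" using g cardX by auto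
    show "2 * card X - g + 1 \<le> card S" using g(3) lower unfolding cardX by linarith
  qed
qed

end

section \<open>Case distinction by the number and sizes of the classes\<close>

context semitransitive_pinj
begin

text \<open>With \<open>x\<close> in a smallest class, a third class supplies enough extra links for
  \<open>g = 1\<close>; for two classes of equal size that size is the divisor; otherwise the cells
  provide \<open>g\<close>.\<close>

lemma card_ge:
  obtains g where "g dvd card X" "g < card X" "2 * card X - g + 1 \<le> card S"
proof -
  obtain x where x: "x \<in> X" "\<And>w. w \<in> X \<Longrightarrow> card (dclass x) \<le> card (dclass w)"
    using ex_has_least_nat[of "\<lambda>w. w \<in> X" _ "\<lambda>w. card (dclass w)"] X_nonempty by blast
  have notX: "D w \<noteq> X" if "w \<in> X" for w using id_D_in_S[OF that] id_notin_S by metis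
  obtain y where y: "y \<in> X" "D y \<noteq> D x"
  proof (rule ccontr)
    assume "\<not> thesis"
    then have "D v = D x" if "v \<in> X" for v using that \<open>\<And>y. \<lbrakk>y \<in> X; D y \<noteq> D x\<rbrakk> \<Longrightarrow> thesis\<close> by blast
    then have "X \<subseteq> D x" using mem_D by blast
    then show False using D_subset_X[OF x(1)] notX[OF x(1)] by blast
  qed
  have "card {x, y} \<le> card X" using x y finite_X by (intro card_mono) auto
  moreover have "x \<noteq> y" using y by auto
  ultimately have two: "2 \<le> card X" by simp
  show ?thesis
  proof (cases "\<exists>z\<in>X. D z \<noteq> D x \<and> D z \<noteq> D y")
    case True
    then obtain z where z: "z \<in> X" "D z \<noteq> D x" "D z \<noteq> D y" by blast
    have "2 * card X - card (dclass x) + card (dclass z) + 1 \<le> card S"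
      by (rule card_ge_star[OF x(1) y(1) subset_refl]) (use y z in auto)
    then have "2 * card X - 1 + 1 \<le> card S" using x(2)[OF z(1)] by linarith
    then show ?thesis using that[of 1] two by simp
  next
    case False
    then have cover: "D z = D x \<or> D z = D y" if "z \<in> X" for z using that by blast
    have XU: "X = dclass x \<union> dclass y" using cover by (auto simp: dclass_def)
    have "finite (dclass x)" "finite (dclass y)" using finite_X by (auto simp: dclass_def)
    then have cX: "card X = card (dclass x) + card (dclass y)"
      using y(2) by (subst XU, intro card_Un_disjoint) (auto simp: dclass_def)
    show ?thesis
    proof (cases "card (dclass x) = card (dclass y)")
      case True
      have "2 * card X - card (dclass x) + card ({} :: 'a set) + 1 \<le> card S"
        by (rule card_ge_star[OF x(1) y(1) empty_subsetI]) auto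
      then show ?thesis using that[of "card (dclass x)"] cX True two by simp
    next
      case False
      \<comment> \<open>With only two classes, a point of \<open>D w\<close> from the other class
        would make \<open>D w\<close> all of \<open>X\<close>, whose identity is not in
        \<open>S\<close>.\<close>
      have disj: "D v = D w" if wv: "w \<in> X" "v \<in> D w" for w v
      proof (rule ccontr)
        assume ne: "D v \<noteq> D w"
        have vX: "v \<in> X" using D_subset_X wv by blast
        have "u \<in> D w" if "u \<in> X" for u
        proof -
          have "D u = D w \<or> D u = D v" using cover[OF that] cover[OF wv(1)] cover[OF vX] ne by metis
          then show ?thesis using mem_D[of u] D_mono[OF wv] by blast
        qed
        then show False using D_subset_X[OF wv(1)] notX[OF wv(1)] by blast
      qed
      have Dcl: "D w = dclass w" if "w \<in> X" for w
        using disj[OF that] D_subset_X[OF that] mem_D unfolding dclass_def by blast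
      interpret semitransitive_pinj_disjoint X S
      proof
        show "D v = D w" if "w \<in> X" "v \<in> D w" for w v using disj that by blast
        show "D w = D v" if "w \<in> X" "v \<in> X" "card (D w) = card (D v)" for w v
          using cover[OF that(1)] cover[OF that(2)] that(3) False Dcl[OF x(1)] Dcl[OF y(1)] by metis
      qed
      show ?thesis using card_ge_cells[OF x(1) y(1)] y(2) that by metis
    qed
  qed
qed

end

theorem theorem3p5:
  fixes n :: nat and S :: "(nat \<rightharpoonup> nat) set"
  assumes "n \<ge> 2"
    and "S \<subseteq> nonperm_pinj n"
    and "comp_closed S"
    and "semitransitive n S"
  shows "card S \<ge> 2 * n - greatest_proper_divisor n + 1"
proof -
  have pinj: "partial_inj n f" "\<not> is_perm n f" if "f \<in> S" for f
    using assms(2) that by (auto simp: nonperm_pinj_def)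
  interpret semitransitive_pinj "{1..n}" S
  proof
    show "{1..n} \<noteq> {}" using assms(1) by simp
    show "dom f \<subseteq> {1..n}" "ran f \<subseteq> {1..n}" if "f \<in> S" for f
      using pinj[OF that] by (auto simp: partial_inj_def)
    show "x = y" if "f \<in> S" "f x = Some z" "f y = Some z" for f x y z
      using pinj(1)[OF that(1)] that(2,3) unfolding partial_inj_def by (metis domI inj_onD)
    show "g \<circ>\<^sub>m f \<in> S" if "f \<in> S" "g \<in> S" for f g
      using assms(3) that by (auto simp: comp_closed_def)
    show "\<exists>f\<in>S. f x = Some y \<or> f y = Some x" if "x \<in> {1..n}" "y \<in> {1..n}" for x y
      using assms(4) that unfolding semitransitive_def by blast
    have "ran (Some |` {1..n}) = {1..n}" unfolding ran_def restrict_Some_iff by blast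
    moreover have "inj_on (Some |` {1..n}) {1..n}" by (simp add: inj_on_def restrict_map_def)
    ultimately have "is_perm n (Some |` {1..n})" by (simp add: is_perm_def partial_inj_def)
    then show "Some |` {1..n} \<notin> S" using pinj(2) by blast
  qed simp
  obtain g where g: "g dvd n" "g < n" "2 * n - g + 1 \<le> card S"
    by (rule card_ge) (auto intro: that)
  have "finite {d. d dvd n \<and> d \<noteq> n}"
    using assms(1) by (intro finite_subset[OF _ finite_divisors_nat[of n]]) auto
  \<comment> \<open>\<open>g\<close> is one of the proper divisors, and replacing it by a larger one
    only weakens the bound.\<close>
  then have "g \<le> greatest_proper_divisor n"
    unfolding greatest_proper_divisor_def using g by (intro Max_ge) auto
  then show ?thesis using g(3) by linarith
qed

end
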